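(* Let $M=(\mathcal{S},\mathcal{A},r,P,\gamma,\rho)$ be a finite discounted Markov decision process, let $\phi:\mathcal{S}\to\{1,\dots,m\}$ be a state aggregation, and let $\epsilon_\phi$ be its inherent state aggregation error. Suppose $\rho(\phi^{-1}(i))>0$ for each $i\in\{1,\dots,m\}$. Let $\pi^*$ be an optimal policy. If $\pi_\infty\in\Pi_\phi$ is a first-order stationary point of $J$ on $\Pi_\phi$, then $$J(\pi^* )-J(\pi_\infty)\;\le\;(1-\gamma)\,\|V_{\pi_\infty}-V^*\|_\infty\;\le\;2\epsilon_\phi .$$
   Context: MDP. $\mathcal{S}$ and $\mathcal{A}$ are finite nonempty sets of states and actions, $r:\mathcal{S}\times\mathcal{A}\to\mathbb{R}$ is the reward function, $P(s'\mid s,a)$ is the probability of moving to $s'$ when action $a$ is taken in state $s$, $\gamma\in(0,1)$ is the discount factor, and $\rho$ is a probability distribution on $\mathcal{S}$ (initial distribution). Policies. $\Delta(\mathcal{A})$ is the set of probability distributions on $\mathcal{A}$. $\Pi$ is the set of stationary randomized policies $\pi:\mathcal{S}\to\Delta(\mathcal{A})$; $\pi(s,a)$ is the probability of action $a$ in state $s$, and $\pi$ is identified with a vector in $\mathbb{R}^{|\mathcal{S}|\cdot|\mathcal{A}|}$. Values. $V_\pi(s)=\mathbb{E}_s^\pi[\sum_{t=0}^\infty\gamma^t r(s_t,a_t)]$ is the expected discounted reward when $s_0=s$ and $\pi$ is applied; $V^*(s)=\max_{\pi\in\Pi}V_\pi(s)$. A policy $\pi^*\in\Pi$ is optimal if $V_{\pi^*}(s)=V^*(s)$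 for all $s\in\mathcal{S}$. $Q_\pi(s,a)=r(s,a)+\gamma\sum_{s'\in\mathcal{S}}P(s'\mid s,a)V_\pi(s')$. Objective. $J(\pi)=(1-\gamma)\sum_{s\in\mathcal{S}}\rho(s)V_\pi(s)$. Writing $r_\pi(s)=\sum_a\pi(s,a)r(s,a)$ and $P_\pi(s,s')=\sum_a\pi(s,a)P(s'\mid s,a)$, one has $J(\pi)=(1-\gamma)\rho(I-\gamma P_\pi)^{-1}r_\pi$, which extends smoothly to a neighborhood of $\Pi$ in $\mathbb{R}^{|\mathcal{S}|\cdot|\mathcal{A}|}$; $\nabla J$ is its gradient and $\langle\cdot,\cdot\rangle$ is the Euclidean inner product. State aggregation. A function $\phi:\mathcal{S}\to\{1,\dots,m\}$ partitions $\mathcal{S}$ into segments $\phi^{-1}(i)$. $\Pi_\phi=\{\pi\in\Pi:\pi(s)=\pi(s')\text{ for all }s,s'\in\mathcal{S}\text{ with }\phi(s)=\phi(s')\}$. Inherent state aggregation error. $\epsilon_\phi$ is the smallest scalar such that $|Q_\pi(s,a)-Q_\pi(s',a)|\le\epsilon_\phi$ for every $\pi\in\Pi_\phi$, every $a\in\mathcal{A}$, and all $s,s'\in\mathcal{S}$ with $\phi(s)=\phi(s')$. Stationary point. A policy $\pi$ is a first-order stationary point of $J$ on $\Pi_\phi$ if $\langle\nabla J(\pi),\pi'-\pi\rangle\le 0$ for all $\pi'\in\Pi_\phi$. *)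

theory Defs
  imports "HOL-Analysis.Analysis" "HOL-Probability.Probability"
begin

(* The state and action sets are the universes of the types 's and 'a, which the definitions
   below require to be finite (nonemptiness is automatic). *)
record ('s, 'a) mdp =
  reward :: "'s \<Rightarrow> 'a \<Rightarrow> real"
  trans :: "'s \<Rightarrow> 'a \<Rightarrow> 's pmf"
  discount :: real
  init :: "'s pmf"

(* The probability of action a in state s is \<pi> $ s $ a; the inner product of real ^ 'a ^ 's is
   the Euclidean one on the coordinates indexed by state-action pairs. *)
definition policies :: "(real ^ 'a::finite ^ 's::finite) set" where
  "policies = {\<pi>. \<forall>s. (\<forall>a. 0 \<le> \<pi> $ s $ a) \<and> (\<Sum>a\<in>UNIV. \<pi> $ s $ a) = 1}"

(* Meaningful for \<pi> in policies only; for other vectors it is an unspecified distribution. *)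
definition action_pmf :: "real ^ 'a::finite ^ 's::finite \<Rightarrow> 's \<Rightarrow> 'a pmf" where
  "action_pmf \<pi> s = embed_pmf (\<lambda>a. \<pi> $ s $ a)"

definition state_action_pmf :: "real ^ 'a::finite ^ 's::finite \<Rightarrow> 's pmf \<Rightarrow> ('s \<times> 'a) pmf" where
  "state_action_pmf \<pi> \<mu> = bind_pmf \<mu> (\<lambda>s. map_pmf (Pair s) (action_pmf \<pi> s))"

(* Conditional law of (s_t, a_t) given the history \<omega> 0, ..., \<omega> (t - 1) of state-action pairs,
   for the process started in s_0 = s. *)
definition step_kernel ::
  "('s::finite, 'a::finite) mdp \<Rightarrow> real ^ 'a ^ 's \<Rightarrow> 's \<Rightarrow> nat \<Rightarrow> (nat \<Rightarrow> 's \<times> 'a) \<Rightarrow> ('s \<times> 'a) measure"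
where
  "step_kernel M \<pi> s t \<omega> = measure_pmf (state_action_pmf \<pi>
     (case t of 0 \<Rightarrow> return_pmf s | Suc n \<Rightarrow> case \<omega> n of (x, a) \<Rightarrow> trans M x a))"

(* The Ionescu-Tulcea measure on infinite trajectories of state-action pairs. *)
definition traj_measure ::
  "('s::finite, 'a::finite) mdp \<Rightarrow> real ^ 'a ^ 's \<Rightarrow> 's \<Rightarrow> (nat \<Rightarrow> 's \<times> 'a) measure"
where
  "traj_measure M \<pi> s = projective_family.lim UNIV
     (Ionescu_Tulcea.CI (step_kernel M \<pi> s) (\<lambda>_. count_space UNIV)) (\<lambda>_. count_space UNIV)"

lemma Ionescu_Tulcea_step_kernel:
  fixes M :: "('s::finite, 'a::finite) mdp"
  shows "Ionescu_Tulcea (step_kernel M \<pi> s) (\<lambda>_. count_space UNIV)"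
proof (rule Ionescu_Tulcea.intro)
  fix t
  show "step_kernel M \<pi> s t \<in>
    measurable (Pi\<^sub>M {0..<t} (\<lambda>_. count_space UNIV)) (subprob_algebra (count_space UNIV))"
  proof (cases t)
    case 0
    then show ?thesis
      by (simp add: step_kernel_def[abs_def] measure_pmf_in_subprob_algebra)
  next
    case (Suc n)
    have "(\<lambda>\<omega>. \<omega> n) \<in> measurable (Pi\<^sub>M {0..<t} (\<lambda>_. count_space UNIV)) (count_space UNIV)"
      using Suc by (intro measurable_component_singleton) simp
    then have "(\<lambda>\<omega>. measure_pmf (state_action_pmf \<pi> (case \<omega> n of (x, a) \<Rightarrow> trans M x a)))
      \<in> measurable (Pi\<^sub>M {0..<t} (\<lambda>_. count_space UNIV)) (subprob_algebra (count_space UNIV))"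
      by (rule measurable_compose) (simp add: measure_pmf_in_subprob_algebra)
    then show ?thesis
      using Suc by (simp add: step_kernel_def[abs_def])
  qed
next
  fix t and \<omega> :: "nat \<Rightarrow> 's \<times> 'a"
  show "prob_space (step_kernel M \<pi> s t \<omega>)"
    unfolding step_kernel_def by (rule measure_pmf.prob_space_axioms)
qed

definition value_fn :: "('s::finite, 'a::finite) mdp \<Rightarrow> real ^ 'a ^ 's \<Rightarrow> real ^ 's" where
  "value_fn M \<pi> = (\<chi> s. \<integral>\<omega>. (\<Sum>t. discount M ^ t * reward M (fst (\<omega> t)) (snd (\<omega> t))) \<partial>traj_measure M \<pi> s)"

definition opt_value :: "('s::finite, 'a::finite) mdp \<Rightarrow> real ^ 's" where
  "opt_value M = (\<chi> s. GREATEST v. v \<in> (\<lambda>\<pi>. value_fn M \<pi> $ s) ` policies)"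

definition optimal_policy :: "('s::finite, 'a::finite) mdp \<Rightarrow> real ^ 'a ^ 's \<Rightarrow> bool" where
  "optimal_policy M \<pi> \<longleftrightarrow> \<pi> \<in> policies \<and> (\<forall>s. value_fn M \<pi> $ s = opt_value M $ s)"

definition q_value :: "('s::finite, 'a::finite) mdp \<Rightarrow> real ^ 'a ^ 's \<Rightarrow> 's \<Rightarrow> 'a \<Rightarrow> real" where
  "q_value M \<pi> s a = reward M s a + discount M * (\<Sum>s'\<in>UNIV. pmf (trans M s a) s' * value_fn M \<pi> $ s')"

definition objective :: "('s::finite, 'a::finite) mdp \<Rightarrow> real ^ 'a ^ 's \<Rightarrow> real" where
  "objective M \<pi> = (1 - discount M) * (\<Sum>s\<in>UNIV. pmf (init M) s * value_fn M \<pi> $ s)"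

definition policy_reward :: "('s::finite, 'a::finite) mdp \<Rightarrow> real ^ 'a ^ 's \<Rightarrow> real ^ 's" where
  "policy_reward M \<pi> = (\<chi> s. \<Sum>a\<in>UNIV. \<pi> $ s $ a * reward M s a)"

definition policy_trans :: "('s::finite, 'a::finite) mdp \<Rightarrow> real ^ 'a ^ 's \<Rightarrow> real ^ 's ^ 's" where
  "policy_trans M \<pi> = (\<chi> s s'. \<Sum>a\<in>UNIV. \<pi> $ s $ a * pmf (trans M s a) s')"

(* The smooth extension of the objective from policies to a neighbourhood of policies; the objective itself has no
   meaning off policies, so gradients are taken of objective_ext. *)
definition objective_ext :: "('s::finite, 'a::finite) mdp \<Rightarrow> real ^ 'a ^ 's \<Rightarrow> real" where
  "objective_ext M \<pi> = (1 - discount M) *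
     ((\<chi> s. pmf (init M) s) \<bullet>
      (matrix_inv (mat 1 - discount M *\<^sub>R policy_trans M \<pi>) *v policy_reward M \<pi>))"

definition grad_objective :: "('s::finite, 'a::finite) mdp \<Rightarrow> real ^ 'a ^ 's \<Rightarrow> real ^ 'a ^ 's" where
  "grad_objective M \<pi> = (THE D. GDERIV (objective_ext M) \<pi> :> D)"

definition aggregated_policies :: "('s::finite \<Rightarrow> nat) \<Rightarrow> (real ^ 'a::finite ^ 's) set" where
  "aggregated_policies \<phi> = {\<pi> \<in> policies. \<forall>s s'. \<phi> s = \<phi> s' \<longrightarrow> \<pi> $ s = \<pi> $ s'}"

definition aggregation_error :: "('s::finite, 'a::finite) mdp \<Rightarrow> ('s \<Rightarrow> nat) \<Rightarrow> real" where
  "aggregation_error M \<phi> = (LEAST e. \<forall>\<pi>\<in>aggregated_policies \<phi>. \<forall>a s s'.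
     \<phi> s = \<phi> s' \<longrightarrow> \<bar>q_value M \<pi> s a - q_value M \<pi> s' a\<bar> \<le> e)"

definition stationary_point ::
  "('s::finite, 'a::finite) mdp \<Rightarrow> (real ^ 'a ^ 's) set \<Rightarrow> real ^ 'a ^ 's \<Rightarrow> bool"
where
  "stationary_point M C \<pi> \<longleftrightarrow> (\<forall>\<pi>'\<in>C. grad_objective M \<pi> \<bullet> (\<pi>' - \<pi>) \<le> 0)"

end

theory Submission
  imports Defs
begin

text \<open>By the policy gradient theorem, the derivative of the objective at \<open>\<pi>\<close> towards \<open>\<pi>'\<close> is the
  occupancy-weighted sum over the states of \<open>\<Sum>\<^sub>a \<pi>'(s,a) Q\<^sub>\<pi>(s,a) - V\<^sub>\<pi>(s)\<close>. Apply stationarity with \<open>\<pi>'\<close>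
  switching a single segment to one action \<open>a\<close>. The occupancy of each segment is positive because \<open>\<rho>\<close>
  charges it, and within the segment \<open>Q\<^sub>\<pi>\<close> and \<open>V\<^sub>\<pi>\<close> vary by at most \<open>\<epsilon>\<^sub>\<phi>\<close>; hence
  \<open>Q\<^sub>\<pi>(s,a) \<le> V\<^sub>\<pi>(s) + 2\<epsilon>\<^sub>\<phi>\<close> for all \<open>s\<close> and \<open>a\<close>. So a Bellman backup of \<open>V\<^sub>\<pi>\<close> under \<open>\<pi>\<^sup>*\<close> exceeds \<open>V\<^sub>\<pi>\<close>
  by at most \<open>2\<epsilon>\<^sub>\<phi>\<close>, and the minimum principle for \<open>I - \<gamma>P\<close> bounds \<open>V\<^sup>* - V\<^sub>\<pi>\<close> by \<open>2\<epsilon>\<^sub>\<phi>/(1 - \<gamma>)\<close>.\<close>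

section \<open>Trajectory measure and its one-time marginals\<close>

text \<open>Only the first \<open>Suc n\<close> coordinates matter, and on them the limit measure is
  the finite composition \<open>C 0 (Suc n)\<close>. Its last step is a bind with the kernel
  \<open>P n\<close>, so coordinate \<open>n\<close> can be integrated out given the
  history.\<close>

lemma (in Ionescu_Tulcea) nn_integral_lim_component:
  assumes f[measurable]: "f \<in> borel_measurable (M n)"
  shows "(\<integral>\<^sup>+\<omega>. f (\<omega> n) \<partial>PF.lim) = (\<integral>\<^sup>+\<omega>. (\<integral>\<^sup>+x. f x \<partial>P n (restrict \<omega> {0..<n})) \<partial>PF.lim)"
proof -
  \<comment> \<open>\<open>CI\<close> is built from \<open>C\<close> by way of cylinder sets; for
    the full initial segment the embedding \<open>prod_emb\<close> is the identity.\<close>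
  have CI_C: "CI {0..<k} = C 0 k (\<lambda>_. undefined)" for k
  proof (rule measure_eqI)
    show "sets (CI {0..<k}) = sets (C 0 k (\<lambda>_. undefined))"
      by (simp add: PF.sets_P sets_C)
    fix A assume "A \<in> sets (CI {0..<k})"
    then show "emeasure (CI {0..<k}) A = emeasure (C 0 k (\<lambda>_. undefined)) A"
      using sets.sets_into_space[of A "PiM {0..<k} M"]
      by (subst emeasure_CI[of _ k]) (simp_all add: PF.sets_P prod_emb_id space_PiM)
  qed
  have lim_C: "(\<integral>\<^sup>+\<omega>. g (restrict \<omega> {0..<k}) \<partial>PF.lim) = (\<integral>\<^sup>+\<omega>. g \<omega> \<partial>C 0 k (\<lambda>_. undefined))"
    if [measurable]: "g \<in> borel_measurable (PiM {0..<k} M)" for g :: "_ \<Rightarrow> ennreal" and k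
  proof -
    have [measurable]: "(\<lambda>\<omega>. restrict \<omega> {0..<k}) \<in> measurable PF.lim (PiM {0..<k} M)"
      by (subst measurable_cong_sets[OF PF.sets_lim refl]) (rule measurable_restrict_subset, simp)
    show ?thesis
      unfolding CI_C[symmetric] distr_lim[of "{0..<k}", simplified, symmetric]
      by (subst nn_integral_distr) simp_all
  qed
  have "(\<integral>\<^sup>+\<omega>. f (\<omega> n) \<partial>PF.lim) = (\<integral>\<^sup>+\<omega>. f ((restrict \<omega> {0..<Suc n}) n) \<partial>PF.lim)"
    by simp
  also have "\<dots> = (\<integral>\<^sup>+\<omega>. f (\<omega> n) \<partial>C 0 (Suc n) (\<lambda>_. undefined))"
    by (rule lim_C) simp
  also have "\<dots> = (\<integral>\<^sup>+\<omega>. (\<integral>\<^sup>+\<omega>'. f (\<omega>' n) \<partial>eP n \<omega>) \<partial>C 0 n (\<lambda>_. undefined))"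
    by (simp, subst nn_integral_bind[where B="PiM {0..<Suc n} M"])
       (simp_all add: measurable_cong_sets[OF sets_C refl])
  also have "\<dots> = (\<integral>\<^sup>+\<omega>. (\<integral>\<^sup>+x. f x \<partial>P n \<omega>) \<partial>C 0 n (\<lambda>_. undefined))"
    by (rule nn_integral_cong) (simp add: space_C nn_integral_eP)
  also have "\<dots> = (\<integral>\<^sup>+\<omega>. (\<integral>\<^sup>+x. f x \<partial>P n (restrict \<omega> {0..<n})) \<partial>PF.lim)"
    by (rule lim_C[symmetric]) measurable
  finally show ?thesis .
qed

text \<open>The law of the state at time \<open>t\<close>, obtained by a Markov recursion that never
  mentions trajectories. \<open>distr_traj_measure\<close> links it to
  \<open>traj_measure\<close>.\<close>

primrec state_law :: "('s::finite, 'a::finite) mdp \<Rightarrow> real ^ 'a ^ 's \<Rightarrow> 's \<Rightarrow> nat \<Rightarrow> 's pmf" where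
  "state_law M \<pi> s 0 = return_pmf s"
| "state_law M \<pi> s (Suc t) = bind_pmf (state_action_pmf \<pi> (state_law M \<pi> s t)) (\<lambda>(x, a). trans M x a)"

lemma prob_space_traj_measure:
  fixes M :: "('s::finite, 'a::finite) mdp"
  shows "prob_space (traj_measure M \<pi> s)"
proof -
  interpret IT: Ionescu_Tulcea "step_kernel M \<pi> s" "\<lambda>_. count_space UNIV"
    by (rule Ionescu_Tulcea_step_kernel)
  \<comment> \<open>The marginal on the empty index set is a probability measure, and a push-forward
    keeps the total mass.\<close>
  have "prob_space (distr IT.PF.lim (PiM {} (\<lambda>_. count_space UNIV)) (\<lambda>\<omega>. restrict \<omega> {}))"
    unfolding IT.distr_lim[OF finite.emptyI] by (rule IT.PF.prob_space_P) simp_all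
  then show ?thesis
    unfolding traj_measure_def
    by (rule prob_space_distrD[rotated]) (simp add: measurable_cong_sets[OF IT.PF.sets_lim refl] space_PiM)
qed

lemma sets_traj_measure [measurable_cong, simp]:
  fixes M :: "('s::finite, 'a::finite) mdp"
  shows "sets (traj_measure M \<pi> s) = sets (Pi\<^sub>M UNIV (\<lambda>_. count_space UNIV))"
proof -
  interpret IT: Ionescu_Tulcea "step_kernel M \<pi> s" "\<lambda>_. count_space UNIV"
    by (rule Ionescu_Tulcea_step_kernel)
  show ?thesis
    unfolding traj_measure_def by (rule IT.PF.sets_lim)
qed

text \<open>Markov property: after time 0 the kernel sees the history only through its last entry,
  whose law is the induction hypothesis, so one more step is a bind of pmfs.\<close>

lemma distr_traj_measure:
  fixes M :: "('s::finite, 'a::finite) mdp"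
  shows "distr (traj_measure M \<pi> s) (count_space UNIV) (\<lambda>\<omega>. \<omega> t)
    = measure_pmf (state_action_pmf \<pi> (state_law M \<pi> s t))"
proof -
  interpret IT: Ionescu_Tulcea "step_kernel M \<pi> s" "\<lambda>_. count_space UNIV"
    by (rule Ionescu_Tulcea_step_kernel)
  interpret traj: prob_space "traj_measure M \<pi> s"
    by (rule prob_space_traj_measure)
  have emeasure: "emeasure (distr (traj_measure M \<pi> s) (count_space UNIV) (\<lambda>\<omega>. \<omega> t)) A
    = (\<integral>\<^sup>+\<omega>. emeasure (step_kernel M \<pi> s t (restrict \<omega> {0..<t})) A \<partial>traj_measure M \<pi> s)" for t A
  proof -
    have "emeasure (distr (traj_measure M \<pi> s) (count_space UNIV) (\<lambda>\<omega>. \<omega> t)) A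
      = (\<integral>\<^sup>+\<omega>. indicator A (\<omega> t) \<partial>traj_measure M \<pi> s)"
      by (subst nn_integral_indicator[symmetric], simp, subst nn_integral_distr) simp_all
    also have "\<dots> = (\<integral>\<^sup>+\<omega>. (\<integral>\<^sup>+x. indicator A x \<partial>step_kernel M \<pi> s t (restrict \<omega> {0..<t})) \<partial>traj_measure M \<pi> s)"
      unfolding traj_measure_def by (rule IT.nn_integral_lim_component) simp
    finally show ?thesis
      by (simp add: step_kernel_def)
  qed
  show ?thesis
  proof (induction t)
    case 0
    show ?case
      by (rule measure_eqI) (simp_all add: emeasure step_kernel_def traj.emeasure_space_1)
  next
    case (Suc t)
    let ?K = "\<lambda>z. state_action_pmf \<pi> (case z of (x, a) \<Rightarrow> trans M x a)"
    have law: "state_action_pmf \<pi> (state_law M \<pi> s (Suc t)) =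
      bind_pmf (state_action_pmf \<pi> (state_law M \<pi> s t)) ?K"
      by (simp add: state_action_pmf_def bind_assoc_pmf)
    show ?case
    proof (rule measure_eqI)
      fix A
      have "emeasure (distr (traj_measure M \<pi> s) (count_space UNIV) (\<lambda>\<omega>. \<omega> (Suc t))) A
        = (\<integral>\<^sup>+\<omega>. emeasure (?K (\<omega> t)) A \<partial>traj_measure M \<pi> s)"
        by (simp add: emeasure step_kernel_def)
      also have "\<dots> = (\<integral>\<^sup>+z. emeasure (?K z) A \<partial>distr (traj_measure M \<pi> s) (count_space UNIV) (\<lambda>\<omega>. \<omega> t))"
        by (subst nn_integral_distr) simp_all
      also have "\<dots> = emeasure (state_action_pmf \<pi> (state_law M \<pi> s (Suc t))) A"
        unfolding Suc.IH law by simp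
      finally show "emeasure (distr (traj_measure M \<pi> s) (count_space UNIV) (\<lambda>\<omega>. \<omega> (Suc t))) A
        = emeasure (state_action_pmf \<pi> (state_law M \<pi> s (Suc t))) A" .
    qed simp
  qed
qed

section \<open>Expectations under a policy and the Bellman equation\<close>

lemma pmf_action_pmf:
  assumes "\<pi> \<in> policies"
  shows "pmf (action_pmf \<pi> s) a = \<pi> $ s $ a"
  unfolding action_pmf_def
proof (rule pmf_embed_pmf)
  show "0 \<le> \<pi> $ s $ x" for x
    using assms by (simp add: policies_def)
  then have "(\<integral>\<^sup>+x. ennreal (\<pi> $ s $ x) \<partial>count_space UNIV) = ennreal (\<Sum>a\<in>UNIV. \<pi> $ s $ a)"
    by (simp add: nn_integral_count_space_finite)
  then show "(\<integral>\<^sup>+x. ennreal (\<pi> $ s $ x) \<partial>count_space UNIV) = 1"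
    using assms by (simp add: policies_def)
qed

lemma expectation_state_action_pmf:
  fixes h :: "'s::finite \<times> 'a::finite \<Rightarrow> real"
  assumes "\<pi> \<in> policies"
  shows "measure_pmf.expectation (state_action_pmf \<pi> \<mu>) h = (\<Sum>s\<in>UNIV. pmf \<mu> s * (\<Sum>a\<in>UNIV. \<pi> $ s $ a * h (s, a)))"
  unfolding state_action_pmf_def
  by (subst pmf_expectation_bind[of UNIV])
     (simp_all add: integral_measure_pmf[of UNIV] pmf_action_pmf[OF assms])

lemma policy_trans_mult:
  "(policy_trans M \<pi> *v v) $ s = (\<Sum>a\<in>UNIV. \<pi> $ s $ a * (\<Sum>s'\<in>UNIV. pmf (trans M s a) s' * v $ s'))"
  by (simp add: policy_trans_def matrix_vector_mult_def sum_distrib_left sum_distrib_right mult.assoc)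
     (rule sum.swap)

text \<open>Duality: moving the law one step forward amounts to averaging the function over one
  transition. This produces the cancellation in the telescoping series of
  \<open>value_fn_eqI\<close>.\<close>

lemma expectation_state_law_Suc:
  assumes "\<pi> \<in> policies"
  shows "(\<Sum>x\<in>UNIV. pmf (state_law M \<pi> s (Suc t)) x * v $ x)
    = (\<Sum>x\<in>UNIV. pmf (state_law M \<pi> s t) x * (policy_trans M \<pi> *v v) $ x)"
proof -
  have "(\<Sum>x\<in>UNIV. pmf (state_law M \<pi> s (Suc t)) x * v $ x)
    = measure_pmf.expectation (state_law M \<pi> s (Suc t)) (\<lambda>x. v $ x)"
    by (subst integral_measure_pmf[of UNIV]) simp_all
  also have "\<dots> = measure_pmf.expectation (state_action_pmf \<pi> (state_law M \<pi> s t))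
      (\<lambda>z. measure_pmf.expectation (case z of (x, a) \<Rightarrow> trans M x a) (\<lambda>x. v $ x))"
    unfolding state_law.simps
    by (subst pmf_expectation_bind[of UNIV]) (simp_all add: integral_measure_pmf[of UNIV])
  also have "\<dots> = (\<Sum>x\<in>UNIV. pmf (state_law M \<pi> s t) x *
      (\<Sum>a\<in>UNIV. \<pi> $ x $ a * (\<Sum>y\<in>UNIV. pmf (trans M x a) y * v $ y)))"
    by (simp add: expectation_state_action_pmf[OF assms] integral_measure_pmf[of UNIV])
  finally show ?thesis
    by (simp add: policy_trans_mult)
qed

text \<open>The equation v = r + \<gamma> P v becomes a linear system with this matrix. The system
  makes sense for vectors outside \<open>policies\<close> too, as differentiation requires.\<close>

definition bellman_matrix :: "('s::finite, 'a::finite) mdp \<Rightarrow> real ^ 'a ^ 's \<Rightarrow> real ^ 's ^ 's" where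
  "bellman_matrix M \<pi> = mat 1 - discount M *\<^sub>R policy_trans M \<pi>"

lemma bellman_matrix_mult: "bellman_matrix M \<pi> *v v = v - discount M *\<^sub>R (policy_trans M \<pi> *v v)"
  by (simp add: bellman_matrix_def matrix_vector_mult_diff_rdistrib scaleR_matrix_vector_assoc)

text \<open>With \<open>v = r\<^sub>\<pi> + \<gamma> P\<^sub>\<pi> v\<close>, the expected discounted reward at time \<open>t\<close> is the decrement of
  \<open>\<gamma>\<^sup>t \<cdot> E[v(s\<^sub>t)]\<close>, so the series telescopes.\<close>

lemma value_fn_eqI:
  fixes M :: "('s::finite, 'a::finite) mdp"
  assumes disc: "0 \<le> discount M" "discount M < 1" and \<pi>: "\<pi> \<in> policies"
    and v: "bellman_matrix M \<pi> *v v = policy_reward M \<pi>"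
  shows "value_fn M \<pi> = v"
proof -
  interpret traj: prob_space "traj_measure M \<pi> s" for s
    by (rule prob_space_traj_measure)
  \<comment> \<open>A bound on all rewards at once; \<open>discount M ^ t * R\<close> is the
    summable majorant that allows sum and integral to be exchanged.\<close>
  define R where "R = (\<Sum>z\<in>UNIV. \<bar>reward M (fst z) (snd z)\<bar>)"
  define g where "g = (\<lambda>(t::nat) (\<omega>::nat \<Rightarrow> 's \<times> 'a). discount M ^ t * reward M (fst (\<omega> t)) (snd (\<omega> t)))"
  have g_le: "norm (g t \<omega>) \<le> discount M ^ t * R" for t \<omega>
  proof -
    have "\<bar>reward M (fst (\<omega> t)) (snd (\<omega> t))\<bar> \<le> R"
      unfolding R_def by (rule member_le_sum[of "\<omega> t" UNIV "\<lambda>z. \<bar>reward M (fst z) (snd z)\<bar>"]) simp_all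
    then show ?thesis
      using disc by (simp add: g_def abs_mult mult_left_mono)
  qed
  have sum_R: "summable (\<lambda>t. discount M ^ t * R)"
    using disc by (intro summable_mult2 summable_geometric) simp
  have [measurable]: "(\<lambda>\<omega>. g t \<omega>) \<in> borel_measurable (traj_measure M \<pi> s)" for t s
  proof -
    have "(\<lambda>\<omega>. \<omega> t) \<in> measurable (traj_measure M \<pi> s) (count_space UNIV)"
      by simp
    then have "(\<lambda>\<omega>. (\<lambda>z. discount M ^ t * reward M (fst z) (snd z)) (\<omega> t)) \<in> borel_measurable (traj_measure M \<pi> s)"
      by (rule measurable_compose) simp
    then show ?thesis
      by (simp add: g_def)
  qed
  have int_g: "integrable (traj_measure M \<pi> s) (g t)" for t s
    by (rule traj.integrable_const_bound[where B="discount M ^ t * R"]) (use g_le in auto)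
  have "value_fn M \<pi> $ s = v $ s" for s
  proof -
    define u where "u = (\<lambda>t. discount M ^ t * (\<Sum>x\<in>UNIV. pmf (state_law M \<pi> s t) x * v $ x))"
    have step: "(\<integral>\<omega>. g t \<omega> \<partial>traj_measure M \<pi> s) = u t - u (Suc t)" for t
    proof -
      have "(\<integral>\<omega>. g t \<omega> \<partial>traj_measure M \<pi> s) = discount M ^ t *
          (\<integral>z. reward M (fst z) (snd z) \<partial>distr (traj_measure M \<pi> s) (count_space UNIV) (\<lambda>\<omega>. \<omega> t))"
        by (subst integral_distr) (simp_all add: g_def)
      also have "\<dots> = discount M ^ t * (\<Sum>x\<in>UNIV. pmf (state_law M \<pi> s t) x * policy_reward M \<pi> $ x)"
        by (simp add: distr_traj_measure expectation_state_action_pmf[OF \<pi>] policy_reward_def)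
      also have "\<dots> = u t - u (Suc t)"
        unfolding v[symmetric] bellman_matrix_mult u_def expectation_state_law_Suc[OF \<pi>]
        by (simp add: algebra_simps sum_subtractf sum_distrib_left)
      finally show ?thesis .
    qed
    \<comment> \<open>Each expectation of \<open>v\<close> is bounded by the sum of its absolute
      entries, so the discount forces decay.\<close>
    have "u \<longlonglongrightarrow> 0"
    proof (rule tendsto_rabs_zero_cancel, rule tendsto_sandwich[of "\<lambda>_. 0"])
      show "\<forall>\<^sub>F t in sequentially. \<bar>u t\<bar> \<le> discount M ^ t * (\<Sum>x\<in>UNIV. \<bar>v $ x\<bar>)"
      proof (intro always_eventually allI)
        fix t
        have "\<bar>\<Sum>x\<in>UNIV. pmf (state_law M \<pi> s t) x * v $ x\<bar> \<le> (\<Sum>x\<in>UNIV. \<bar>v $ x\<bar>)"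
          by (rule order_trans[OF sum_abs], rule sum_mono)
             (simp add: abs_mult mult_left_le_one_le pmf_le_1)
        then show "\<bar>u t\<bar> \<le> discount M ^ t * (\<Sum>x\<in>UNIV. \<bar>v $ x\<bar>)"
          using disc by (simp add: u_def abs_mult mult_left_mono)
      qed
      show "(\<lambda>t. discount M ^ t * (\<Sum>x\<in>UNIV. \<bar>v $ x\<bar>)) \<longlonglongrightarrow> 0"
        using disc by (intro tendsto_mult_left_zero LIMSEQ_power_zero) simp
    qed simp_all
    then have "(\<lambda>t. u t - u (Suc t)) sums (u 0 - 0)"
      by (rule telescope_sums')
    moreover have "u 0 = v $ s"
      by (simp add: u_def indicator_def of_bool_def if_distrib[of "\<lambda>x. x * _"] cong: if_cong)
    moreover have "(\<lambda>t. \<integral>\<omega>. g t \<omega> \<partial>traj_measure M \<pi> s) sums (\<integral>\<omega>. (\<Sum>t. g t \<omega>) \<partial>traj_measure M \<pi> s)"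
    proof (rule sums_integral[OF int_g])
      show "AE \<omega> in traj_measure M \<pi> s. summable (\<lambda>t. norm (g t \<omega>))"
        by (intro AE_I2 summable_comparison_test'[OF sum_R]) (use g_le in simp)
      show "summable (\<lambda>t. \<integral>\<omega>. norm (g t \<omega>) \<partial>traj_measure M \<pi> s)"
      proof (rule summable_comparison_test'[OF sum_R, of 0])
        fix t
        have "(\<integral>\<omega>. norm (g t \<omega>) \<partial>traj_measure M \<pi> s) \<le> discount M ^ t * R"
          by (rule traj.integral_le_const) (use int_g g_le in auto)
        then show "norm (\<integral>\<omega>. norm (g t \<omega>) \<partial>traj_measure M \<pi> s) \<le> discount M ^ t * R"
          by simp
      qed
    qed
    ultimately have "(\<integral>\<omega>. (\<Sum>t. g t \<omega>) \<partial>traj_measure M \<pi> s) = v $ s"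
      by (simp add: step sums_unique2)
    then show ?thesis
      by (simp add: value_fn_def g_def)
  qed
  then show ?thesis
    by (simp add: vec_eq_iff)
qed

section \<open>Differentiability of solutions of linear systems, and gradients\<close>

text \<open>By the Leibniz formula the determinant is a polynomial in the entries.\<close>

lemma det_differentiable:
  fixes A :: "'x::real_normed_vector \<Rightarrow> real ^ 'n ^ 'n"
  assumes "\<And>i j. (\<lambda>x. A x $ i $ j) differentiable (at x within S)"
  shows "(\<lambda>x. det (A x)) differentiable (at x within S)"
proof -
  have "(\<lambda>x. \<Prod>i\<in>UNIV. A x $ i $ p i) differentiable (at x within S)" for p :: "'n \<Rightarrow> 'n"
  proof -
    from assms have "\<forall>i. \<exists>D. ((\<lambda>x. A x $ i $ p i) has_derivative D) (at x within S)"
      by (simp add: differentiable_def)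
    then obtain D where "\<And>i. ((\<lambda>x. A x $ i $ p i) has_derivative D i) (at x within S)"
      by metis
    then show ?thesis
      using has_derivative_prod[of UNIV "\<lambda>i x. A x $ i $ p i" D x S]
      unfolding differentiable_def by blast
  qed
  then show ?thesis
    unfolding det_def by (intro differentiable_sum differentiable_mult) (simp_all add: finite_permutations)
qed

lemma matrix_inv_mult_eqI:
  fixes A :: "real ^ 'n ^ 'n"
  assumes "invertible A" "A *v x = b"
  shows "matrix_inv A *v b = x"
proof -
  have "matrix_inv A ** A = mat 1"
    using assms(1) unfolding invertible_def matrix_inv_def by (metis (mono_tags, lifting) someI_ex)
  then show ?thesis
    using assms(2) by (metis matrix_vector_mul_assoc matrix_vector_mul_lid)
qed

lemma mult_matrix_inv_mult:
  fixes A :: "real ^ 'n ^ 'n"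
  assumes "invertible A"
  shows "A *v (matrix_inv A *v b) = b"
proof -
  have "A ** matrix_inv A = mat 1"
    using assms(1) unfolding invertible_def matrix_inv_def by (metis (mono_tags, lifting) someI_ex)
  then show ?thesis
    by (simp add: matrix_vector_mul_assoc)
qed

text \<open>Cramer's rule writes the component as a quotient of determinants. It applies where
  \<open>det (A x)\<close> is nonzero, hence near \<open>x0\<close> by continuity, and that suffices
  to transfer the derivative.\<close>

lemma matrix_inv_mult_differentiable:
  fixes A :: "'x::real_normed_vector \<Rightarrow> real ^ 'n ^ 'n" and b :: "'x \<Rightarrow> real ^ 'n"
  assumes A: "\<And>i j. (\<lambda>x. A x $ i $ j) differentiable (at x0)"
    and b: "\<And>i. (\<lambda>x. b x $ i) differentiable (at x0)"
    and inv: "invertible (A x0)"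
  shows "(\<lambda>x. (matrix_inv (A x) *v b x) $ k) differentiable (at x0)"
proof -
  let ?B = "\<lambda>x. \<chi> i j. if j = k then b x $ i else A x $ i $ j"
  have det0: "det (A x0) \<noteq> 0"
    using inv by (simp add: invertible_det_nz)
  have detA: "(\<lambda>x. det (A x)) differentiable (at x0)"
    by (rule det_differentiable[OF A])
  have "(\<lambda>x. ?B x $ i $ j) differentiable (at x0)" for i j
    using A b by (cases "j = k") simp_all
  then have detB: "(\<lambda>x. det (?B x)) differentiable (at x0)"
    by (rule det_differentiable)
  have eq: "det (?B x) / det (A x) = (matrix_inv (A x) *v b x) $ k" if "det (A x) \<noteq> 0" for x
  proof -
    have "A x *v (matrix_inv (A x) *v b x) = b x"
      using that by (simp add: mult_matrix_inv_mult invertible_det_nz)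
    then have "matrix_inv (A x) *v b x = (\<chi> k. det (\<chi> i j. if j = k then b x $ i else A x $ i $ j) / det (A x))"
      using cramer[OF that] by blast
    then show ?thesis by simp
  qed
  have "((\<lambda>x. det (A x)) \<longlongrightarrow> det (A x0)) (at x0)"
    using differentiable_imp_continuous_within[OF detA] by (simp add: continuous_within)
  then have "\<forall>\<^sub>F x in at x0. det (A x) \<noteq> 0"
    using det0 by (rule tendsto_imp_eventually_ne)
  then have ev: "\<forall>\<^sub>F x in at x0. det (?B x) / det (A x) = (matrix_inv (A x) *v b x) $ k"
    by (rule eventually_mono) (rule eq)
  have "(\<lambda>x. det (?B x) / det (A x)) differentiable (at x0)"
    by (rule differentiable_divide[OF detB detA det0])
  then obtain D where "((\<lambda>x. det (?B x) / det (A x)) has_derivative D) (at x0)"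
    unfolding differentiable_def by blast
  then have "((\<lambda>x. (matrix_inv (A x) *v b x) $ k) has_derivative D) (at x0)"
    by (rule has_derivative_transform_eventually[OF _ ev eq[OF det0] UNIV_I])
  then show ?thesis
    unfolding differentiable_def by blast
qed

text \<open>Riesz representation: the gradient is the adjoint of the derivative at 1. Together with
  \<open>GDERIV_unique\<close> this makes the description in \<open>grad_objective\<close>
  denote.\<close>

lemma GDERIV_exists:
  fixes f :: "'a::euclidean_space \<Rightarrow> real"
  assumes "f differentiable (at x)"
  shows "\<exists>D. GDERIV f x :> D"
proof -
  obtain f' where f': "(f has_derivative f') (at x)"
    using assms unfolding differentiable_def by blast
  then have "f' = (\<lambda>h. h \<bullet> adjoint f' 1)"
    by (simp add: adjoint_works[OF has_derivative_linear] fun_eq_iff)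
  with f' show ?thesis
    unfolding gderiv_def by metis
qed

lemma GDERIV_unique:
  fixes f :: "'a::euclidean_space \<Rightarrow> real"
  assumes "GDERIV f x :> D" "GDERIV f x :> E"
  shows "D = E"
proof -
  have "(\<lambda>h. h \<bullet> D) = (\<lambda>h. h \<bullet> E)"
    using assms unfolding gderiv_def by (rule has_derivative_unique)
  then have "(D - E) \<bullet> (D - E) = 0"
    by (metis inner_diff_right right_minus_eq)
  then show ?thesis by simp
qed

lemma GDERIV_directional:
  assumes "GDERIV f x :> D"
  shows "((\<lambda>t. f (x + t *\<^sub>R h)) has_real_derivative D \<bullet> h) (at 0)"
proof -
  have 1: "((\<lambda>t. x + t *\<^sub>R h) has_derivative (\<lambda>t. t *\<^sub>R h)) (at (0::real))"
    by (auto intro!: derivative_eq_intros)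
  have "(f has_derivative (\<lambda>h. h \<bullet> D)) (at (x + (0::real) *\<^sub>R h))"
    using assms by (simp add: gderiv_def)
  from has_derivative_compose[OF 1 this]
  have "((\<lambda>t. f (x + t *\<^sub>R h)) has_derivative (\<lambda>t. t * (D \<bullet> h))) (at 0)"
    by (simp add: inner_commute)
  moreover have "(\<lambda>t. t * (D \<bullet> h)) = (*) (D \<bullet> h)"
    by (simp add: fun_eq_iff)
  ultimately show ?thesis
    unfolding has_field_derivative_def by simp
qed

section \<open>Invertibility of the Bellman matrix and the value function as its solution\<close>

lemma policy_trans_stochastic:
  assumes "\<pi> \<in> policies"
  shows "0 \<le> policy_trans M \<pi> $ s $ s'" "(\<Sum>s'\<in>UNIV. policy_trans M \<pi> $ s $ s') = 1"
proof -
  show "0 \<le> policy_trans M \<pi> $ s $ s'"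
    using assms by (simp add: policy_trans_def policies_def sum_nonneg)
  have "(\<Sum>s'\<in>UNIV. policy_trans M \<pi> $ s $ s') = (\<Sum>a\<in>UNIV. \<pi> $ s $ a * (\<Sum>s'\<in>UNIV. pmf (trans M s a) s'))"
    unfolding policy_trans_def by (simp add: sum_distrib_left) (rule sum.swap)
  also have "\<dots> = 1"
    using assms by (simp add: sum_pmf_eq_1 policies_def)
  finally show "(\<Sum>s'\<in>UNIV. policy_trans M \<pi> $ s $ s') = 1" .
qed

text \<open>Minimum principle: evaluate the hypothesis at a state minimizing \<open>x\<close>, where the transition
  average of \<open>x\<close> is at least \<open>x\<close>.\<close>

lemma bellman_matrix_lower_bound:
  fixes M :: "('s::finite, 'a::finite) mdp"
  assumes disc: "0 \<le> discount M" "discount M < 1" and \<pi>: "\<pi> \<in> policies"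
    and le: "\<And>s. c \<le> (bellman_matrix M \<pi> *v x) $ s"
  shows "c \<le> (1 - discount M) * x $ s"
proof -
  obtain i where i: "\<And>j. x $ i \<le> x $ j"
    using arg_min_if_finite[of UNIV "\<lambda>s. x $ s"] by (metis UNIV_I UNIV_not_empty finite_code linorder_not_less)
  have "x $ i = (\<Sum>j\<in>UNIV. policy_trans M \<pi> $ i $ j * x $ i)"
    by (simp add: sum_distrib_right[symmetric] policy_trans_stochastic[OF \<pi>])
  also have "\<dots> \<le> (policy_trans M \<pi> *v x) $ i"
    unfolding matrix_vector_mult_def
    by (simp add: sum_mono mult_left_mono i policy_trans_stochastic[OF \<pi>])
  finally have "discount M * x $ i \<le> discount M * (policy_trans M \<pi> *v x) $ i"
    using disc by (simp add: mult_left_mono)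
  with le[of i] have "c \<le> (1 - discount M) * x $ i"
    by (simp add: bellman_matrix_mult algebra_simps)
  also have "\<dots> \<le> (1 - discount M) * x $ s"
    using disc i by (simp add: mult_left_mono)
  finally show ?thesis .
qed

text \<open>The minimum principle applied to \<open>x\<close> and \<open>- x\<close> shows that the
  kernel is trivial.\<close>

lemma invertible_bellman_matrix:
  fixes M :: "('s::finite, 'a::finite) mdp"
  assumes disc: "0 \<le> discount M" "discount M < 1" and \<pi>: "\<pi> \<in> policies"
  shows "invertible (bellman_matrix M \<pi>)"
proof -
  have nonneg: "0 \<le> x $ s" if "bellman_matrix M \<pi> *v x = 0" for x s
    using bellman_matrix_lower_bound[OF disc \<pi>, of 0 x s] that disc by (simp add: zero_le_mult_iff)
  have "x = 0" if "bellman_matrix M \<pi> *v x = 0" for x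
    using nonneg[OF that] nonneg[of "- x"] that
    by (simp add: vec_eq_iff vec.neg order_antisym)
  then show ?thesis
    unfolding invertible_left_inverse matrix_left_invertible_ker by blast
qed

text \<open>Invertibility supplies a solution of the linear system, and \<open>value_fn_eqI\<close>
  identifies it with the trajectory expectation.\<close>

lemma bellman_matrix_value_fn:
  fixes M :: "('s::finite, 'a::finite) mdp"
  assumes "0 \<le> discount M" "discount M < 1" "\<pi> \<in> policies"
  shows "bellman_matrix M \<pi> *v value_fn M \<pi> = policy_reward M \<pi>"
  using value_fn_eqI[OF assms mult_matrix_inv_mult] invertible_bellman_matrix[OF assms]
  by (simp add: mult_matrix_inv_mult)

lemma value_fn_eq_matrix_inv:
  fixes M :: "('s::finite, 'a::finite) mdp"
  assumes "0 \<le> discount M" "discount M < 1" "\<pi> \<in> policies"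
  shows "value_fn M \<pi> = matrix_inv (bellman_matrix M \<pi>) *v policy_reward M \<pi>"
  by (rule matrix_inv_mult_eqI[symmetric, OF invertible_bellman_matrix bellman_matrix_value_fn]) fact+

section \<open>Differentiability of the objective, and advantages\<close>

lemma policy_component_differentiable: "(\<lambda>\<pi>::real ^ 'a::finite ^ 's::finite. \<pi> $ s $ a) differentiable F"
proof -
  have "bounded_linear (\<lambda>\<pi>::real ^ 'a ^ 's. \<pi> $ s $ a)"
    by (rule bounded_linear_compose[OF bounded_linear_vec_nth bounded_linear_vec_nth])
  then show ?thesis
    using bounded_linear_imp_has_derivative differentiable_def by blast
qed

lemma bellman_matrix_component_differentiable:
  "(\<lambda>\<pi>. bellman_matrix M \<pi> $ i $ j) differentiable (at \<pi>0)"
  unfolding bellman_matrix_def policy_trans_def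
  by (simp add: policy_component_differentiable)

lemma policy_reward_component_differentiable:
  "(\<lambda>\<pi>. policy_reward M \<pi> $ i) differentiable (at \<pi>0)"
  unfolding policy_reward_def
  by (simp add: policy_component_differentiable)

lemma objective_ext_eq:
  "objective_ext M \<pi> = (1 - discount M) *
    (\<Sum>s\<in>UNIV. pmf (init M) s * (matrix_inv (bellman_matrix M \<pi>) *v policy_reward M \<pi>) $ s)"
  unfolding objective_ext_def bellman_matrix_def by (simp add: inner_vec_def)

lemma GDERIV_grad_objective:
  fixes M :: "('s::finite, 'a::finite) mdp"
  assumes "0 \<le> discount M" "discount M < 1" "\<pi> \<in> policies"
  shows "GDERIV (objective_ext M) \<pi> :> grad_objective M \<pi>"
proof -
  have "objective_ext M differentiable (at \<pi>)"
    unfolding objective_ext_eq[abs_def]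
    by (simp add: matrix_inv_mult_differentiable bellman_matrix_component_differentiable
        policy_reward_component_differentiable invertible_bellman_matrix assms)
  then show ?thesis
    unfolding grad_objective_def using GDERIV_exists GDERIV_unique by (metis theI)
qed

text \<open>The bridge from matrices to Q-values: the gain from one step of \<open>\<pi>'\<close>
  followed by \<open>\<pi>\<close> is the residual of \<open>value_fn M \<pi>\<close> in the Bellman
  equation of \<open>\<pi>'\<close>. It serves for \<open>\<pi>\<close> itself (residual zero), for
  points between two policies and for the optimal policy.\<close>

lemma advantage_eq:
  fixes M :: "('s::finite, 'a::finite) mdp"
  shows "(policy_reward M \<pi>' - bellman_matrix M \<pi>' *v value_fn M \<pi>) $ s
    = (\<Sum>a\<in>UNIV. \<pi>' $ s $ a * q_value M \<pi> s a) - value_fn M \<pi> $ s"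
proof -
  have "(\<Sum>a\<in>UNIV. \<pi>' $ s $ a * q_value M \<pi> s a)
    = policy_reward M \<pi>' $ s + discount M * (policy_trans M \<pi>' *v value_fn M \<pi>) $ s"
    unfolding q_value_def policy_trans_mult distrib_left sum.distrib
    by (simp add: policy_reward_def sum_distrib_left mult.left_commute)
  then show ?thesis
    by (simp add: bellman_matrix_mult)
qed

lemma value_fn_eq_sum_q_value:
  fixes M :: "('s::finite, 'a::finite) mdp"
  assumes "0 \<le> discount M" "discount M < 1" "\<pi> \<in> policies"
  shows "value_fn M \<pi> $ s = (\<Sum>a\<in>UNIV. \<pi> $ s $ a * q_value M \<pi> s a)"
  using advantage_eq[of M \<pi> \<pi> s] bellman_matrix_value_fn[OF assms] by simp

section \<open>Compactness of the policy set: optimal values and aggregation error\<close>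

lemma convex_policies: "convex policies"
  unfolding convex_def policies_def
  by (simp add: sum.distrib sum_distrib_left[symmetric])

lemma compact_policies: "compact (policies :: (real ^ 'a::finite ^ 's::finite) set)"
proof (rule compact_eq_bounded_closed[THEN iffD2], rule conjI)
  have "norm \<pi> \<le> real CARD('s)" if "\<pi> \<in> policies" for \<pi> :: "real ^ 'a ^ 's"
  proof -
    have "norm (\<pi> $ s) \<le> 1" for s
      using norm_le_l1_cart[of "\<pi> $ s"] that by (simp add: policies_def)
    then have "(\<Sum>s\<in>UNIV. norm (\<pi> $ s)) \<le> (\<Sum>s\<in>(UNIV::'s set). 1)"
      by (intro sum_mono)
    then show ?thesis
      using L2_set_le_sum[of UNIV "\<lambda>s. norm (\<pi> $ s)"] by (simp add: norm_vec_def)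
  qed
  then show "bounded (policies :: (real ^ 'a ^ 's) set)"
    by (rule boundedI)
  show "closed (policies :: (real ^ 'a ^ 's) set)"
    unfolding policies_def
    by (intro closed_Collect_all closed_Collect_conj closed_Collect_le closed_Collect_eq continuous_intros)
qed

lemma continuous_on_value_fn:
  fixes M :: "('s::finite, 'a::finite) mdp"
  assumes "0 \<le> discount M" "discount M < 1"
  shows "continuous_on policies (\<lambda>\<pi>. value_fn M \<pi> $ s)"
proof -
  have "continuous_on policies (\<lambda>\<pi>. (matrix_inv (bellman_matrix M \<pi>) *v policy_reward M \<pi>) $ s)"
    by (intro continuous_at_imp_continuous_on ballI differentiable_imp_continuous_within
        matrix_inv_mult_differentiable bellman_matrix_component_differentiable
        policy_reward_component_differentiable invertible_bellman_matrix assms)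
  then show ?thesis
    by (rule continuous_on_eq) (simp add: value_fn_eq_matrix_inv[OF assms])
qed

text \<open>A continuous function on the compact set of policies attains its maximum, so the
  \<open>GREATEST\<close> in \<open>opt_value\<close> denotes that maximum.\<close>

lemma value_fn_le_opt_value:
  fixes M :: "('s::finite, 'a::finite) mdp"
  assumes disc: "0 \<le> discount M" "discount M < 1" and \<pi>: "\<pi> \<in> policies"
  shows "value_fn M \<pi> $ s \<le> opt_value M $ s"
proof -
  obtain \<pi>' where "\<pi>' \<in> policies" and max: "\<forall>\<pi>\<in>policies. value_fn M \<pi> $ s \<le> value_fn M \<pi>' $ s"
    using continuous_attains_sup[OF compact_policies _ continuous_on_value_fn[OF disc]] \<pi> by blast
  then have "opt_value M $ s = value_fn M \<pi>' $ s"
    unfolding opt_value_def vec_lambda_beta by (intro Greatest_equality) auto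
  with max \<pi> show ?thesis by simp
qed

text \<open>The \<open>LEAST\<close> in \<open>aggregation_error\<close> has to be shown to exist.
  Q-values are bounded by compactness, so the differences in question have a supremum, and this is
  the least admissible scalar.\<close>

lemma q_value_diff_le_aggregation_error:
  fixes M :: "('s::finite, 'a::finite) mdp"
  assumes disc: "0 \<le> discount M" "discount M < 1"
    and \<pi>: "\<pi> \<in> aggregated_policies \<phi>" and "\<phi> s = \<phi> s'"
  shows "\<bar>q_value M \<pi> s a - q_value M \<pi> s' a\<bar> \<le> aggregation_error M \<phi>"
proof -
  let ?E = "{\<bar>q_value M \<pi> s a - q_value M \<pi> s' a\<bar> | \<pi> s s' a. \<pi> \<in> aggregated_policies \<phi> \<and> \<phi> s = \<phi> s'}"
  have "\<exists>B. \<forall>\<pi>\<in>policies. \<bar>q_value M \<pi> s a\<bar> \<le> B" for s a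
  proof -
    have "continuous_on policies (\<lambda>\<pi>. q_value M \<pi> s a)"
      unfolding q_value_def by (intro continuous_intros continuous_on_value_fn disc)
    then have "bounded ((\<lambda>\<pi>. q_value M \<pi> s a) ` policies)"
      by (intro compact_imp_bounded compact_continuous_image compact_policies)
    then show ?thesis
      by (auto simp: bounded_iff)
  qed
  then obtain B where B: "\<And>\<pi> s a. \<pi> \<in> policies \<Longrightarrow> \<bar>q_value M \<pi> s a\<bar> \<le> B s a"
    by metis
  \<comment> \<open>Summing over the finitely many pairs turns the bounds \<open>B s a\<close> into
    a single one.\<close>
  define K where "K = (\<Sum>(s, a)\<in>UNIV. \<bar>B s a\<bar>)"
  have K: "\<bar>q_value M \<pi> s a\<bar> \<le> K" if "\<pi> \<in> aggregated_policies \<phi>" for \<pi> s a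
  proof -
    have "\<bar>q_value M \<pi> s a\<bar> \<le> \<bar>B s a\<bar>"
      using B[of \<pi> s a] that by (simp add: aggregated_policies_def)
    also have "\<dots> \<le> K"
      unfolding K_def using member_le_sum[of "(s, a)" UNIV "\<lambda>(s, a). \<bar>B s a\<bar>"] by auto
    finally show ?thesis .
  qed
  have "x \<le> 2 * K" if "x \<in> ?E" for x
  proof -
    from that obtain \<pi> s s' a where "x = \<bar>q_value M \<pi> s a - q_value M \<pi> s' a\<bar>" "\<pi> \<in> aggregated_policies \<phi>"
      by blast
    with K[of \<pi> s a] K[of \<pi> s' a] show ?thesis by linarith
  qed
  then have bdd: "bdd_above ?E"
    by (rule bdd_aboveI)
  have mem: "\<bar>q_value M \<pi> s a - q_value M \<pi> s' a\<bar> \<in> ?E"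
    if "\<pi> \<in> aggregated_policies \<phi>" "\<phi> s = \<phi> s'" for \<pi> s s' a
    using that by blast
  have "aggregation_error M \<phi> = Sup ?E"
    unfolding aggregation_error_def
  proof (rule Least_equality)
    show "\<forall>\<pi>\<in>aggregated_policies \<phi>. \<forall>a s s'. \<phi> s = \<phi> s' \<longrightarrow> \<bar>q_value M \<pi> s a - q_value M \<pi> s' a\<bar> \<le> Sup ?E"
      by (intro ballI allI impI cSup_upper[OF mem bdd])
    fix e
    assume e: "\<forall>\<pi>\<in>aggregated_policies \<phi>. \<forall>a s s'. \<phi> s = \<phi> s' \<longrightarrow> \<bar>q_value M \<pi> s a - q_value M \<pi> s' a\<bar> \<le> e"
    show "Sup ?E \<le> e"
    proof (rule cSup_least)
      show "?E \<noteq> {}"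
        using mem[OF \<pi> \<open>\<phi> s = \<phi> s'\<close>] by (metis empty_iff)
      show "x \<le> e" if "x \<in> ?E" for x
      proof -
        from that obtain \<pi> s s' a where "x = \<bar>q_value M \<pi> s a - q_value M \<pi> s' a\<bar>"
          and "\<pi> \<in> aggregated_policies \<phi>" "\<phi> s = \<phi> s'"
          by blast
        with e show ?thesis by simp
      qed
    qed
  qed
  then show ?thesis
    using cSup_upper[OF mem[OF \<pi> \<open>\<phi> s = \<phi> s'\<close>] bdd] by simp
qed

section \<open>Occupancy measure and policy gradient\<close>

text \<open>Up to the factor \<open>1 - discount M\<close>, this is the discounted state occupancy measure of \<open>\<pi>\<close>.\<close>

definition occupancy :: "('s::finite, 'a::finite) mdp \<Rightarrow> real ^ 'a ^ 's \<Rightarrow> 's \<Rightarrow> real" where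
  "occupancy M \<pi> s = (\<Sum>x\<in>UNIV. pmf (init M) x * matrix_inv (bellman_matrix M \<pi>) $ x $ s)"

lemma sum_occupancy:
  "(\<Sum>s\<in>UNIV. occupancy M \<pi> s * g $ s) =
    (\<Sum>x\<in>UNIV. pmf (init M) x * (matrix_inv (bellman_matrix M \<pi>) *v g) $ x)"
  unfolding occupancy_def matrix_vector_mult_def
  by (simp add: sum_distrib_left sum_distrib_right mult.assoc) (rule sum.swap)

text \<open>Occupancy includes the visit at time 0. For the column \<open>x\<close> of the inverse
  at \<open>s\<close>, the Bellman matrix sends \<open>x - axis s 1\<close> to a nonnegative vector,
  so the minimum principle gives \<open>x\<close> at least \<open>axis s 1\<close> in every
  entry.\<close>

lemma init_le_occupancy:
  fixes M :: "('s::finite, 'a::finite) mdp"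
  assumes disc: "0 \<le> discount M" "discount M < 1" and \<pi>: "\<pi> \<in> policies"
  shows "pmf (init M) s \<le> occupancy M \<pi> s"
proof -
  note lower = bellman_matrix_lower_bound[OF disc \<pi>, of 0]
  define x where "x = matrix_inv (bellman_matrix M \<pi>) *v axis s 1"
  have x: "bellman_matrix M \<pi> *v x = axis s 1"
    unfolding x_def by (rule mult_matrix_inv_mult[OF invertible_bellman_matrix[OF disc \<pi>]])
  have "0 \<le> (bellman_matrix M \<pi> *v (x - axis s 1)) $ i" for i
  proof -
    have "bellman_matrix M \<pi> *v (x - axis s 1) = discount M *\<^sub>R (policy_trans M \<pi> *v axis s 1)"
      using x by (simp add: matrix_vector_mult_diff_distrib bellman_matrix_mult[of M \<pi> "axis s 1"])
    then show ?thesis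
      using disc by (simp add: matrix_vector_mult_basis column_def policy_trans_stochastic[OF \<pi>])
  qed
  then have ge: "axis s 1 $ i \<le> x $ i" for i
    using lower[of "x - axis s 1" i] disc by (simp add: zero_le_mult_iff)
  have "pmf (init M) s = (\<Sum>i\<in>UNIV. pmf (init M) i * (axis s 1 :: real ^ 's) $ i)"
    by (simp add: axis_def if_distrib[of "\<lambda>c. _ * c"] cong: if_cong)
  also have "\<dots> \<le> (\<Sum>i\<in>UNIV. pmf (init M) i * x $ i)"
    using ge by (intro sum_mono mult_left_mono) simp_all
  also have "\<dots> = occupancy M \<pi> s"
    unfolding occupancy_def x_def by (simp add: matrix_vector_mult_basis column_def)
  finally show ?thesis .
qed

text \<open>Policy gradient theorem. With \<open>\<pi>\<^sub>t = \<pi> + t (\<pi>' - \<pi>)\<close>, the difference quotient of the objective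
  at \<open>t\<close> is the right-hand side with the Bellman matrix of \<open>\<pi>\<close> replaced by that of \<open>\<pi>\<^sub>t\<close>.\<close>

lemma grad_objective_inner:
  fixes M :: "('s::finite, 'a::finite) mdp"
  assumes disc: "0 \<le> discount M" "discount M < 1" and \<pi>: "\<pi> \<in> policies" and \<pi>': "\<pi>' \<in> policies"
  shows "grad_objective M \<pi> \<bullet> (\<pi>' - \<pi>) = (1 - discount M) *
    (\<Sum>s\<in>UNIV. occupancy M \<pi> s * ((\<Sum>a\<in>UNIV. \<pi>' $ s $ a * q_value M \<pi> s a) - value_fn M \<pi> $ s))"
proof -
  define g where "g = (\<chi> s. (\<Sum>a\<in>UNIV. \<pi>' $ s $ a * q_value M \<pi> s a) - value_fn M \<pi> $ s)"
  define h where "h = \<pi>' - \<pi>"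
  define K where "K \<psi> = (1 - discount M) * (\<Sum>s\<in>UNIV. pmf (init M) s * (matrix_inv (bellman_matrix M \<psi>) *v g) $ s)" for \<psi>
  \<comment> \<open>For these \<open>t\<close> the point is a convex combination of two policies, so
    its Bellman matrix is invertible; hence the one-sided limits at \<open>at_right 0\<close>
    below.\<close>
  have quotient: "(objective_ext M (\<pi> + t *\<^sub>R h) - objective_ext M \<pi>) / t = K (\<pi> + t *\<^sub>R h)"
    if t: "0 < t" "t \<le> 1" for t
  proof -
    let ?p = "\<pi> + t *\<^sub>R h"
    let ?N = "matrix_inv (bellman_matrix M ?p)"
    have "?p = (1 - t) *\<^sub>R \<pi> + t *\<^sub>R \<pi>'"
      by (simp add: h_def algebra_simps)
    then have p: "?p \<in> policies"
      using convexD[OF convex_policies \<pi> \<pi>', of "1 - t" t] t by simp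
    \<comment> \<open>The advantage is affine in the policy and vanishes at \<open>\<pi>\<close>, so
      only \<open>t\<close> times the advantage of \<open>\<pi>'\<close> is left.\<close>
    have adv: "policy_reward M ?p - bellman_matrix M ?p *v value_fn M \<pi> = t *\<^sub>R g"
      by (simp only: vec_eq_iff advantage_eq)
         (simp add: g_def h_def algebra_simps sum.distrib sum_subtractf sum_distrib_left
           value_fn_eq_sum_q_value[OF disc \<pi>])
    then have "bellman_matrix M ?p *v (?N *v policy_reward M ?p - value_fn M \<pi>) = t *\<^sub>R g"
      by (simp add: matrix_vector_mult_diff_distrib mult_matrix_inv_mult[OF invertible_bellman_matrix[OF disc p]])
    from matrix_inv_mult_eqI[OF invertible_bellman_matrix[OF disc p] this]
    have "?N *v policy_reward M ?p - matrix_inv (bellman_matrix M \<pi>) *v policy_reward M \<pi> = t *\<^sub>R (?N *v g)"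
      by (simp add: value_fn_eq_matrix_inv[OF disc \<pi>] matrix_vector_mult_scaleR)
    then have eq: "(?N *v policy_reward M ?p) $ s = (matrix_inv (bellman_matrix M \<pi>) *v policy_reward M \<pi>) $ s + t * (?N *v g) $ s" for s
      by (simp add: vec_eq_iff algebra_simps)
    have "objective_ext M ?p - objective_ext M \<pi> = t * K ?p"
      unfolding objective_ext_eq K_def eq
      by (simp add: algebra_simps sum.distrib sum_distrib_left)
    then show ?thesis
      using t by simp
  qed
  have "((\<lambda>t. (objective_ext M (\<pi> + t *\<^sub>R h) - objective_ext M \<pi>) / t) \<longlongrightarrow> grad_objective M \<pi> \<bullet> h) (at_right 0)"
    using GDERIV_directional[OF GDERIV_grad_objective[OF disc \<pi>], of h]
    by (auto simp: has_field_derivative_iff intro: filterlim_mono[OF _ order_refl at_le])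
  moreover have "\<forall>\<^sub>F t in at_right 0. (objective_ext M (\<pi> + t *\<^sub>R h) - objective_ext M \<pi>) / t = K (\<pi> + t *\<^sub>R h)"
    unfolding eventually_at_right_field by (intro exI[of _ 1]) (simp add: quotient)
  ultimately have "((\<lambda>t. K (\<pi> + t *\<^sub>R h)) \<longlongrightarrow> grad_objective M \<pi> \<bullet> h) (at_right 0)"
    by (rule Lim_transform_eventually)
  moreover have "((\<lambda>t. K (\<pi> + t *\<^sub>R h)) \<longlongrightarrow> K \<pi>) (at_right 0)"
  proof -
    have "K differentiable (at \<pi>)"
      unfolding K_def[abs_def]
      by (simp add: matrix_inv_mult_differentiable bellman_matrix_component_differentiable
          invertible_bellman_matrix disc \<pi>)
    then have "isCont K \<pi>"
      by (rule differentiable_imp_continuous_within)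
    moreover have "((\<lambda>t. \<pi> + t *\<^sub>R h) \<longlongrightarrow> \<pi>) (at_right (0::real))"
      by (auto intro!: tendsto_eq_intros)
    ultimately show ?thesis
      by (rule isCont_tendsto_compose)
  qed
  ultimately have "grad_objective M \<pi> \<bullet> h = K \<pi>"
    by (rule tendsto_unique[OF trivial_limit_at_right_real])
  then show ?thesis
    unfolding K_def sum_occupancy[symmetric] h_def g_def by simp
qed

section \<open>Consequences of stationarity on a segment\<close>

lemma stationary_point_q_value_le:
  fixes M :: "('s::finite, 'a::finite) mdp"
  assumes disc: "0 \<le> discount M" "discount M < 1"
    and pos: "measure_pmf.prob (init M) (\<phi> -` {\<phi> s}) > 0"
    and agg: "\<pi> \<in> aggregated_policies \<phi>"
    and stat: "stationary_point M (aggregated_policies \<phi>) \<pi>"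
  shows "q_value M \<pi> s a \<le> value_fn M \<pi> $ s + 2 * aggregation_error M \<phi>"
proof -
  define S where "S = \<phi> -` {\<phi> s}"
  \<comment> \<open>Switching the whole segment of \<open>s\<close> to \<open>a\<close>, and not
    \<open>s\<close> alone, keeps the policy aggregated.\<close>
  define \<pi>' where "\<pi>' = (\<chi> x. if x \<in> S then axis a 1 else \<pi> $ x)"
  let ?g = "\<lambda>x. (\<Sum>b\<in>UNIV. \<pi>' $ x $ b * q_value M \<pi> x b) - value_fn M \<pi> $ x"
  let ?c = "q_value M \<pi> s a - value_fn M \<pi> $ s - 2 * aggregation_error M \<phi>"
  have \<pi>: "\<pi> \<in> policies"
    using agg by (simp add: aggregated_policies_def)
  have err: "\<bar>q_value M \<pi> x b - q_value M \<pi> s b\<bar> \<le> aggregation_error M \<phi>" if "x \<in> S" for x b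
    using that by (intro q_value_diff_le_aggregation_error[OF disc agg]) (simp add: S_def)
  have "(\<Sum>b\<in>UNIV. (axis a 1 :: real ^ 'a) $ b) = 1"
    by (simp add: axis_def)
  with \<pi> have \<pi>': "\<pi>' \<in> policies"
    by (auto simp: policies_def \<pi>'_def axis_def)
  have "\<pi>' $ x = \<pi>' $ y" if "\<phi> x = \<phi> y" for x y
  proof -
    have "\<pi> $ x = \<pi> $ y"
      using agg that unfolding aggregated_policies_def by blast
    with that show ?thesis by (simp add: \<pi>'_def S_def)
  qed
  with \<pi>' have "\<pi>' \<in> aggregated_policies \<phi>"
    unfolding aggregated_policies_def by blast
  with stat have "grad_objective M \<pi> \<bullet> (\<pi>' - \<pi>) \<le> 0"
    by (simp add: stationary_point_def)
  then have "(\<Sum>x\<in>UNIV. occupancy M \<pi> x * ?g x) \<le> 0"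
    using disc by (simp add: grad_objective_inner[OF disc \<pi> \<pi>'] mult_le_0_iff)
  also have "(\<Sum>x\<in>UNIV. occupancy M \<pi> x * ?g x) = (\<Sum>x\<in>S. occupancy M \<pi> x * ?g x)"
    by (rule sum.mono_neutral_right) (simp_all add: \<pi>'_def value_fn_eq_sum_q_value[OF disc \<pi>])
  finally have le0: "(\<Sum>x\<in>S. occupancy M \<pi> x * ?g x) \<le> 0" .
  \<comment> \<open>The factor 2 arises here: passing from \<open>x\<close> to \<open>s\<close>
    costs one error for the Q-value of \<open>a\<close> and one for the value. The latter holds
    because \<open>\<pi>\<close> has the same action probabilities at both states.\<close>
  have "?c \<le> ?g x" if x: "x \<in> S" for x
  proof -
    have "\<pi> $ x = \<pi> $ s"
      using agg x unfolding aggregated_policies_def S_def by blast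
    then have "value_fn M \<pi> $ x \<le> (\<Sum>b\<in>UNIV. \<pi> $ s $ b * (q_value M \<pi> s b + aggregation_error M \<phi>))"
      unfolding value_fn_eq_sum_q_value[OF disc \<pi>, of x]
    proof (simp, intro sum_mono mult_left_mono)
      show "q_value M \<pi> x b \<le> q_value M \<pi> s b + aggregation_error M \<phi>" for b
        using err[OF x, of b] by linarith
      show "0 \<le> \<pi> $ s $ b" for b
        using \<pi> by (simp add: policies_def)
    qed
    also have "\<dots> = value_fn M \<pi> $ s + aggregation_error M \<phi>"
      using \<pi> by (simp add: value_fn_eq_sum_q_value[OF disc \<pi>] distrib_left sum.distrib
          sum_distrib_right[symmetric] policies_def)
    finally have "value_fn M \<pi> $ x \<le> value_fn M \<pi> $ s + aggregation_error M \<phi>" .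
    moreover have "(\<Sum>b\<in>UNIV. \<pi>' $ x $ b * q_value M \<pi> x b) = q_value M \<pi> x a"
      using x by (simp add: \<pi>'_def axis_def if_distrib[of "\<lambda>c. c * _"] cong: if_cong)
    ultimately show ?thesis
      using err[OF x, of a] by linarith
  qed
  moreover have occ: "0 \<le> occupancy M \<pi> x" for x
    by (rule order_trans[OF pmf_nonneg init_le_occupancy[OF disc \<pi>]])
  ultimately have "(\<Sum>x\<in>S. occupancy M \<pi> x * ?c) \<le> (\<Sum>x\<in>S. occupancy M \<pi> x * ?g x)"
    by (intro sum_mono mult_left_mono)
  with le0 have "(\<Sum>x\<in>S. occupancy M \<pi> x) * ?c \<le> 0"
    by (simp add: sum_distrib_right)
  moreover have "0 < (\<Sum>x\<in>S. occupancy M \<pi> x)"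
  proof -
    have "0 < (\<Sum>x\<in>S. pmf (init M) x)"
      using pos by (simp add: S_def measure_measure_pmf_finite)
    also have "\<dots> \<le> (\<Sum>x\<in>S. occupancy M \<pi> x)"
      by (rule sum_mono) (rule init_le_occupancy[OF disc \<pi>])
    finally show ?thesis .
  qed
  ultimately show ?thesis
    by (simp add: mult_le_0_iff)
qed

section \<open>Optimality gap of a stationary point\<close>

theorem theorem3:
  fixes M :: "('s::finite, 'a::finite) mdp"
    and \<phi> :: "'s \<Rightarrow> nat" and m :: nat
    and \<pi>_opt \<pi>_inf :: "real ^ 'a ^ 's"
  assumes "0 < discount M" and "discount M < 1"
    and "\<And>s. \<phi> s \<in> {1..m}"
    and "\<And>i. i \<in> {1..m} \<Longrightarrow> measure_pmf.prob (init M) (\<phi> -` {i}) > 0"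
    and "optimal_policy M \<pi>_opt"
    and "\<pi>_inf \<in> aggregated_policies \<phi>"
    and "stationary_point M (aggregated_policies \<phi>) \<pi>_inf"
  shows "objective M \<pi>_opt - objective M \<pi>_inf \<le> (1 - discount M) * infnorm (value_fn M \<pi>_inf - opt_value M)
    \<and> (1 - discount M) * infnorm (value_fn M \<pi>_inf - opt_value M) \<le> 2 * aggregation_error M \<phi>"
proof
  let ?V = "value_fn M \<pi>_inf" and ?e = "aggregation_error M \<phi>"
  have disc: "0 \<le> discount M" "discount M < 1"
    using assms by simp_all
  have inf: "\<pi>_inf \<in> policies"
    using assms by (simp add: aggregated_policies_def)
  have opt: "\<pi>_opt \<in> policies" and V_opt: "value_fn M \<pi>_opt = opt_value M"
    using assms by (simp_all add: optimal_policy_def vec_eq_iff)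
  \<comment> \<open>First inequality: an average over the initial distribution is at most the
    maximal deviation.\<close>
  have "(\<Sum>s\<in>UNIV. pmf (init M) s * (opt_value M $ s - ?V $ s))
      \<le> (\<Sum>s\<in>UNIV. pmf (init M) s * infnorm (?V - opt_value M))"
  proof (intro sum_mono mult_left_mono pmf_nonneg)
    fix s
    show "opt_value M $ s - ?V $ s \<le> infnorm (?V - opt_value M)"
      using component_le_infnorm_cart[of "?V - opt_value M" s] by simp
  qed
  also have "\<dots> = infnorm (?V - opt_value M)"
    by (simp add: sum_distrib_right[symmetric] sum_pmf_eq_1)
  finally have "(1 - discount M) * (\<Sum>s\<in>UNIV. pmf (init M) s * (opt_value M $ s - ?V $ s))
      \<le> (1 - discount M) * infnorm (?V - opt_value M)"
    using disc by (simp add: mult_left_mono)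
  then show "objective M \<pi>_opt - objective M \<pi>_inf \<le> (1 - discount M) * infnorm (?V - opt_value M)"
    by (simp add: objective_def V_opt algebra_simps sum_subtractf)
  have comp: "\<bar>(?V - opt_value M) $ s\<bar> \<le> 2 * ?e / (1 - discount M)" for s
  proof -
    \<comment> \<open>As \<open>opt_value M\<close> solves the Bellman equation of
      \<open>\<pi>_opt\<close>, the right-hand side is minus the expected advantage of
      \<open>\<pi>_opt\<close> over \<open>\<pi>_inf\<close>, and that advantage averages terms of
      at most \<open>2 * ?e\<close>.\<close>
    have "- (2 * ?e) \<le> (bellman_matrix M \<pi>_opt *v (?V - opt_value M)) $ x" for x
    proof -
      have "(policy_reward M \<pi>_opt - bellman_matrix M \<pi>_opt *v ?V) $ x
          \<le> (\<Sum>a\<in>UNIV. \<pi>_opt $ x $ a * (?V $ x + 2 * ?e)) - ?V $ x"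
        unfolding advantage_eq using opt assms
        by (auto simp: policies_def intro!: sum_mono mult_left_mono stationary_point_q_value_le)
      also have "\<dots> = 2 * ?e"
        using opt by (simp add: sum_distrib_right[symmetric] policies_def)
      finally show ?thesis
        using bellman_matrix_value_fn[OF disc opt] by (simp add: V_opt matrix_vector_mult_diff_distrib)
    qed
    then have "- (2 * ?e) \<le> (1 - discount M) * (?V - opt_value M) $ s"
      by (rule bellman_matrix_lower_bound[OF disc opt])
    then have "opt_value M $ s - ?V $ s \<le> 2 * ?e / (1 - discount M)"
      using disc by (simp add: field_simps)
    \<comment> \<open>Optimality settles the other sign of the absolute value.\<close>
    moreover have "?V $ s \<le> opt_value M $ s"
      by (rule value_fn_le_opt_value[OF disc inf])
    ultimately show ?thesis
      by simp
  qed
  have "infnorm (?V - opt_value M) \<le> 2 * ?e / (1 - discount M)"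
    unfolding infnorm_cart by (rule cSup_least) (use comp in auto)
  then show "(1 - discount M) * infnorm (?V - opt_value M) \<le> 2 * ?e"
    using disc by (simp add: field_simps)
qed

end
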